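(* Let $f,g:\mathbb{R}^n\to\mathbb{R}\cup\{\infty\}$ be closed, proper, convex functions, let $\gamma>0$, $z^0\in\mathbb{R}^n$, and let $x^{k+1/2},x^{k+1},z^{k+1}$ ($k=0,1,\dots$) be the DRS iterates. Suppose $d^\star=p^\star$ is finite, the primal problem (P) has a solution, and the dual problem (D) has no solution. Then $x^{k+1}-x^{k+1/2}\to 0$, \[ \lim_{k\to\infty}\frac{1}{k+1}\sum_{i=0}^{k}\bigl(f(x^{i+1/2})+g(x^{i+1})\bigr)=p^\star,\qquad \liminf_{k\to\infty}\bigl(f(x^{k+1/2})+g(x^{k+1})\bigr)=p^\star . \] Furthermore, if $x^{k+1/2}\to x^\star$ for some $x^\star$ (or equivalently if $x^{k+1}\to x^\star$), then $x^\star$ is a solution of (P).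
   Context: A convex function is closed if its epigraph is closed, and proper if it is finite somewhere. $f^*(\nu)=\sup_x\{\langle \nu,x\rangle-f(x)\}$ is the convex conjugate. Primal problem (P): minimize $f(x)+g(x)$ over $x\in\mathbb{R}^n$, with optimal value $p^\star=\inf_x\{f(x)+g(x)\}\in[-\infty,\infty]$. Dual problem (D): maximize $-f^*(\nu)-g^*(-\nu)$ over $\nu\in\mathbb{R}^n$, with optimal value $d^\star=\sup_\nu\{-f^*(\nu)-g^*(-\nu)\}\in[-\infty,\infty]$. A solution of (P) (resp. (D)) is a point attaining the optimal value. $\mathrm{Prox}_h(z)=\arg\min_x\{h(x)+\tfrac12\|x-z\|^2\}$. Douglas--Rachford splitting (DRS) with parameter $\gamma>0$ and starting point $z^0\in\mathbb{R}^n$: for $k=0,1,\dots$, $x^{k+1/2}=\mathrm{Prox}_{\gamma f}(z^k)$, $x^{k+1}=\mathrm{Prox}_{\gamma g}(2x^{k+1/2}-z^k)$, $z^{k+1}=z^k+x^{k+1}-x^{k+1/2}$. *)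

theory Defs
  imports "HOL-Analysis.Analysis"
begin

definition epi :: "('a \<Rightarrow> ereal) \<Rightarrow> ('a \<times> real) set" where
  "epi f = {(x, t). f x \<le> ereal t}"

text \<open>Convexity through the epigraph avoids \<open>\<infinity> - \<infinity>\<close> in Jensen's inequality.\<close>

definition convex_fun :: "('a::real_vector \<Rightarrow> ereal) \<Rightarrow> bool" where
  "convex_fun f \<longleftrightarrow> convex (epi f)"

definition closed_fun :: "('a::topological_space \<Rightarrow> ereal) \<Rightarrow> bool" where
  "closed_fun f \<longleftrightarrow> closed (epi f)"

text \<open>The value \<open>-\<infinity>\<close> is not excluded here; functions into \<open>\<real> \<union> {\<infinity>}\<close> carry this as a separate hypothesis.\<close>

definition proper_fun :: "('a \<Rightarrow> ereal) \<Rightarrow> bool" where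
  "proper_fun f \<longleftrightarrow> (\<exists>x. \<bar>f x\<bar> \<noteq> \<infinity>)"

definition conjugate :: "('a::real_inner \<Rightarrow> ereal) \<Rightarrow> 'a \<Rightarrow> ereal" where
  "conjugate f \<nu> = (SUP x. ereal (\<nu> \<bullet> x) - f x)"

definition primal_value :: "('a \<Rightarrow> ereal) \<Rightarrow> ('a \<Rightarrow> ereal) \<Rightarrow> ereal" where
  "primal_value f g = (INF x. f x + g x)"

definition primal_solution :: "('a \<Rightarrow> ereal) \<Rightarrow> ('a \<Rightarrow> ereal) \<Rightarrow> 'a \<Rightarrow> bool" where
  "primal_solution f g x \<longleftrightarrow> f x + g x = primal_value f g"

definition dual_value :: "('a::real_inner \<Rightarrow> ereal) \<Rightarrow> ('a \<Rightarrow> ereal) \<Rightarrow> ereal" where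
  "dual_value f g = (SUP \<nu>. - conjugate f \<nu> - conjugate g (- \<nu>))"

definition dual_solution :: "('a::real_inner \<Rightarrow> ereal) \<Rightarrow> ('a \<Rightarrow> ereal) \<Rightarrow> 'a \<Rightarrow> bool" where
  "dual_solution f g \<nu> \<longleftrightarrow> - conjugate f \<nu> - conjugate g (- \<nu>) = dual_value f g"

text \<open>The minimizer exists and is unique for closed, proper, convex \<open>h\<close> that never take the value
  \<open>-\<infinity>\<close>; otherwise the value of \<^const>\<open>arg_min\<close> may be arbitrary.\<close>

definition prox :: "('a::real_normed_vector \<Rightarrow> ereal) \<Rightarrow> 'a \<Rightarrow> 'a" where
  "prox h z = arg_min (\<lambda>x. h x + ereal (1 / 2 * (norm (x - z))\<^sup>2)) (\<lambda>_. True)"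

text \<open>\<open>xh k\<close> stands for \<open>x\<^sup>k\<^sup>+\<^sup>1\<^sup>/\<^sup>2\<close>; the value \<open>x 0\<close> is not constrained.\<close>

definition drs_iterates ::
  "('a::real_normed_vector \<Rightarrow> ereal) \<Rightarrow> ('a \<Rightarrow> ereal) \<Rightarrow> real \<Rightarrow> 'a \<Rightarrow>
    (nat \<Rightarrow> 'a) \<Rightarrow> (nat \<Rightarrow> 'a) \<Rightarrow> (nat \<Rightarrow> 'a) \<Rightarrow> bool" where
  "drs_iterates f g \<gamma> z0 xh x z \<longleftrightarrow>
     z 0 = z0 \<and>
     (\<forall>k. xh k = prox (\<lambda>y. ereal \<gamma> * f y) (z k) \<and>
          x (Suc k) = prox (\<lambda>y. ereal \<gamma> * g y) (2 *\<^sub>R xh k - z k) \<and>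
          z (Suc k) = z k + x (Suc k) - xh k)"

end

theory Submission
  imports Defs
begin

text \<open>
  Write \<open>d k = z (Suc k) - z k = x (Suc k) - xh k\<close> and \<open>e k = f (xh k) + g (x (Suc k)) - p\<close>, where
  \<open>p\<close> is the common optimal value, and let \<open>s\<close> be a primal solution. The proof plays two bounds on
  \<open>e\<close> against each other.

  From above: the optimality conditions of the two proximal steps (\<open>prox_subgradient\<close>), tested at
  \<open>s\<close>, add up to
  \<open>2 * \<gamma> * e k \<le> (norm (z k - s))\<^sup>2 - (norm (z (Suc k) - s))\<^sup>2 - (norm (d k))\<^sup>2\<close>.
  The right-hand side telescopes, so the partial sums of \<open>e\<close> are bounded above.

  From below: since the dual value is also \<open>p\<close>, an \<open>\<epsilon>\<close>-optimal dual point \<open>\<nu>\<close> gives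
  \<open>- \<epsilon> - \<nu> \<bullet> d k \<le> e k\<close> for all \<open>k\<close> (\<open>dual_minorant\<close>). Without dual attainment one cannot
  take \<open>\<epsilon> = 0\<close>, and the points \<open>\<nu>\<close> may run off to infinity as \<open>\<epsilon>\<close> tends to \<open>0\<close>. But for each
  fixed \<open>\<epsilon>\<close> the term \<open>\<nu> \<bullet> d k\<close> telescopes too, and combining both bounds yields
  \<open>(\<Sum>k<K. (norm (d k))\<^sup>2) \<le> A + 2 * \<gamma> * \<epsilon> * K\<close> with \<open>A\<close> independent of \<open>K\<close>. The step from
  \<open>z k\<close> to \<open>z (Suc k)\<close> is nonexpansive, so \<open>norm (d k)\<close> is nonincreasing; hence
  \<open>limsup (norm (d k))\<^sup>2 \<le> 2 * \<gamma> * \<epsilon>\<close> for every \<open>\<epsilon>\<close>, which means \<open>d \<longlonglongrightarrow> 0\<close>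
  (\<open>increments_tendsto_0\<close>).

  Now the lower bound gives \<open>liminf e \<ge> 0\<close>. Together with the bounded partial sums this forces the
  averages of \<open>e\<close> to \<open>0\<close> (\<open>average_tendsto_0\<close>) and \<open>liminf e \<le> 0\<close> (\<open>frequently_small\<close>). If
  \<open>xh\<close> converges, then so does \<open>x\<close>, to the same limit because \<open>d \<longlonglongrightarrow> 0\<close>, and lower
  semicontinuity of \<open>f\<close> and \<open>g\<close> (\<open>closed_fun_le_liminf\<close>) bounds the value there by
  \<open>p\<close>.
\<close>

section \<open>Proximal points\<close>

text \<open>A hyperplane separating the closed convex epigraph from a point strictly below it cannot be
  vertical, because the epigraph has a point directly above that one. This is where convexity
  makes the proximal objective coercive.\<close>

lemma affine_minorant:
  fixes h :: "'a::euclidean_space \<Rightarrow> ereal"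
  assumes "\<And>y. h y \<noteq> -\<infinity>" "closed_fun h" "proper_fun h" "convex_fun h"
  shows "\<exists>a \<beta>. \<forall>(x, t)\<in>epi h. \<beta> + a \<bullet> x \<le> t"
proof -
  obtain x0 where "\<bar>h x0\<bar> \<noteq> \<infinity>"
    using assms(3) unfolding proper_fun_def by (rule exE)
  then obtain r where r: "h x0 = ereal r"
    by (rule abs_neq_infinity_cases)
  have "(x0, r - 1) \<notin> epi h"
    by (simp add: epi_def r)
  then obtain w b where w: "w \<bullet> (x0, r - 1) < b" "\<forall>p\<in>epi h. b < w \<bullet> p"
    using separating_hyperplane_closed_point[of "epi h" "(x0, r - 1)"] assms(2,4)
    by (auto simp: closed_fun_def convex_fun_def)
  obtain u v where uv: "w = (u, v)"
    by (cases w)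
  \<comment> \<open>A point of the epigraph directly above the separated one rules out \<open>v \<le> 0\<close>.\<close>
  have "(x0, r) \<in> epi h"
    by (simp add: epi_def r)
  then have "v * (r - 1) < v * r"
    using w uv by (force simp: inner_Pair)
  then have v: "v > 0"
    by (simp add: algebra_simps)
  show ?thesis
  proof (intro exI ballI, clarify)
    fix x t assume "(x, t) \<in> epi h"
    then have "b < u \<bullet> x + v * t"
      using w uv by (force simp: inner_Pair)
    then show "b / v + (- (1 / v) *\<^sub>R u) \<bullet> x \<le> t"
      using v by (simp add: field_simps)
  qed
qed

text \<open>Minimizing over the epigraph instead of over points replaces a lower semicontinuous function
  with values in \<^typ>\<open>ereal\<close> by the continuous real function \<open>\<phi>\<close>. Its sublevel set is compact:
  closed because \<open>epi h\<close> is, and bounded because the quadratic term dominates the affine minorant.\<close>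

lemma prox_objective_attains_min:
  fixes h :: "'a::euclidean_space \<Rightarrow> ereal"
  assumes h: "\<And>y. h y \<noteq> -\<infinity>" "closed_fun h" "proper_fun h" "convex_fun h"
    and \<gamma>: "\<gamma> > 0"
  obtains p r where "(p, r) \<in> epi h"
    "\<And>x t. (x, t) \<in> epi h \<Longrightarrow> \<gamma> * r + 1/2 * (norm (p - z))\<^sup>2 \<le> \<gamma> * t + 1/2 * (norm (x - z))\<^sup>2"
proof -
  obtain a \<beta> where "\<forall>(x, t)\<in>epi h. \<beta> + a \<bullet> x \<le> t"
    using affine_minorant[OF h] by (elim exE)
  then have minorant: "\<beta> + a \<bullet> x \<le> t" if "(x, t) \<in> epi h" for x t
    using that by auto
  obtain x0 where "\<bar>h x0\<bar> \<noteq> \<infinity>"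
    using h(3) unfolding proper_fun_def by (rule exE)
  then obtain r0 where r0: "h x0 = ereal r0"
    by (rule abs_neq_infinity_cases)
  define \<phi> where "\<phi> = (\<lambda>q::'a \<times> real. \<gamma> * snd q + 1/2 * (norm (fst q - z))\<^sup>2)"
  define M where "M = \<phi> (x0, r0)"
  define S where "S = epi h \<inter> {q. \<phi> q \<le> M}"
  define c where "c = z - \<gamma> *\<^sub>R a"
  define R where "R = sqrt (2 * (M - \<gamma> * \<beta> - \<gamma> * (a \<bullet> z)) + (norm (\<gamma> *\<^sub>R a))\<^sup>2)"
  have cont: "continuous_on A \<phi>" for A
    unfolding \<phi>_def by (intro continuous_intros)
  have "closed S"
    unfolding S_def using h(2) closed_Collect_le[OF cont[of UNIV] continuous_on_const]
    by (auto simp: closed_fun_def)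
  moreover have "S \<subseteq> cball c R \<times> {\<beta> - norm a * (norm c + R) .. M / \<gamma>}"
  proof (clarsimp, intro conjI)
    fix x t assume xt: "(x, t) \<in> S"
    have t: "\<beta> + a \<bullet> x \<le> t"
      using minorant xt by (simp add: S_def)
    have M: "\<gamma> * t + 1/2 * (norm (x - z))\<^sup>2 \<le> M"
      using xt by (simp add: S_def \<phi>_def)
    have "\<gamma> * (\<beta> + a \<bullet> x) \<le> \<gamma> * t"
      using t \<gamma> by simp
    \<comment> \<open>Completing the square turns the sublevel condition into a ball around \<open>c\<close>.\<close>
    then have "(norm (x - c))\<^sup>2 \<le> 2 * (M - \<gamma> * \<beta> - \<gamma> * (a \<bullet> z)) + (norm (\<gamma> *\<^sub>R a))\<^sup>2"
      using M unfolding c_def power2_norm_eq_inner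
      by (simp add: inner_simps inner_commute algebra_simps)
    then have "norm (x - c) \<le> R"
      unfolding R_def by (rule real_le_rsqrt)
    then show ball: "dist c x \<le> R"
      by (simp add: dist_norm norm_minus_commute)
    have "norm x \<le> norm c + R"
      using ball norm_triangle_ineq2[of x c] by (simp add: dist_norm norm_minus_commute)
    then have "norm a * norm x \<le> norm a * (norm c + R)"
      by (rule mult_left_mono) simp
    then show "\<beta> - norm a * (norm c + R) \<le> t"
      using t Cauchy_Schwarz_ineq2[of a x] by linarith
    have "0 \<le> 1/2 * (norm (x - z))\<^sup>2"
      by simp
    then have "\<gamma> * t \<le> M"
      using M by linarith
    then show "t \<le> M / \<gamma>"
      using \<gamma> by (simp add: field_simps)
  qed
  then have "bounded S"
    using bounded_subset bounded_Times bounded_cball bounded_closed_interval by metis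
  ultimately have "compact S"
    by (simp add: compact_eq_bounded_closed)
  moreover have x0S: "(x0, r0) \<in> S"
    by (simp add: S_def M_def epi_def r0)
  ultimately obtain q where q: "q \<in> S" "\<forall>q'\<in>S. \<phi> q \<le> \<phi> q'"
    using continuous_attains_inf[OF _ _ cont] by blast
  show thesis
  proof (rule that)
    show "(fst q, snd q) \<in> epi h"
      using q by (simp add: S_def)
    fix x t assume "(x, t) \<in> epi h"
    moreover have "\<phi> q \<le> M"
      using q(2) x0S unfolding M_def by (rule bspec)
    ultimately have "\<phi> q \<le> \<phi> (x, t)"
      using q(2) by (cases "\<phi> (x, t) \<le> M") (auto simp: S_def)
    then show "\<gamma> * snd q + 1/2 * (norm (fst q - z))\<^sup>2 \<le> \<gamma> * t + 1/2 * (norm (x - z))\<^sup>2"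
      by (simp add: \<phi>_def)
  qed
qed

text \<open>The definition of \<^const>\<open>prox\<close> through \<^const>\<open>arg_min\<close> says nothing unless a minimizer exists.
  Bounding \<open>h x\<close> by a real \<open>t\<close> keeps the inequality real-valued and covers the points where \<open>h\<close> is
  infinite vacuously.\<close>

lemma prox_minimizes:
  fixes h :: "'a::euclidean_space \<Rightarrow> ereal" and z :: 'a
  assumes h: "\<And>y. h y \<noteq> -\<infinity>" "closed_fun h" "proper_fun h" "convex_fun h"
    and \<gamma>: "\<gamma> > 0"
  defines "p \<equiv> prox (\<lambda>y. ereal \<gamma> * h y) z"
  obtains r where "h p = ereal r"
    "\<And>x t. h x \<le> ereal t \<Longrightarrow> \<gamma> * r + 1/2 * (norm (p - z))\<^sup>2 \<le> \<gamma> * t + 1/2 * (norm (x - z))\<^sup>2"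
proof -
  let ?\<psi> = "\<lambda>x. ereal \<gamma> * h x + ereal (1 / 2 * (norm (x - z))\<^sup>2)"
  obtain q s where q: "(q, s) \<in> epi h"
    and min: "\<And>x t. (x, t) \<in> epi h \<Longrightarrow>
      \<gamma> * s + 1/2 * (norm (q - z))\<^sup>2 \<le> \<gamma> * t + 1/2 * (norm (x - z))\<^sup>2"
    using prox_objective_attains_min[OF h \<gamma>] by metis
  have "?\<psi> q \<le> ?\<psi> x" for x
  proof (cases "h x")
    case (real t)
    obtain s' where s': "h q = ereal s'" "s' \<le> s"
      using q h(1)[of q] by (cases "h q") (auto simp: epi_def)
    have "\<gamma> * s' \<le> \<gamma> * s"
      using s' \<gamma> by simp
    then show ?thesis
      using min[of x t] real s' by (simp add: epi_def)
  next
    case PInf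
    then show ?thesis using \<gamma> by simp
  next
    case MInf
    then show ?thesis using h(1) by simp
  qed
  then have "is_arg_min ?\<psi> (\<lambda>_. True) q"
    by (simp add: is_arg_min_linorder)
  then have "is_arg_min ?\<psi> (\<lambda>_. True) p"
    unfolding p_def prox_def arg_min_def by (rule someI)
  then have p: "?\<psi> p \<le> ?\<psi> x" for x
    by (simp add: is_arg_min_linorder)
  have "h q \<le> ereal s"
    using q by (simp add: epi_def)
  then have "ereal \<gamma> * h p \<noteq> \<infinity>"
    using p[of q] h(1)[of q] \<gamma> by (cases "h q") auto
  then obtain r where r: "h p = ereal r"
    using h(1)[of p] \<gamma> by (cases "h p") auto
  show thesis
  proof (rule that[OF r])
    fix x t assume le: "h x \<le> ereal t"
    then obtain t' where t': "h x = ereal t'" "t' \<le> t"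
      using h(1)[of x] by (cases "h x") auto
    have "\<gamma> * t' \<le> \<gamma> * t"
      using t' \<gamma> by simp
    then show "\<gamma> * r + 1/2 * (norm (p - z))\<^sup>2 \<le> \<gamma> * t + 1/2 * (norm (x - z))\<^sup>2"
      using p[of x] r t' by simp
  qed
qed

text \<open>Fermat's rule: \<open>(1 / \<gamma>) *\<^sub>R (z - p)\<close> is a subgradient of \<open>h\<close> at \<open>p\<close>. Comparing the minimizer with the points
  \<open>p + s *\<^sub>R (w - p)\<close> and using convexity leaves an error of order \<open>s\<close>, which vanishes as \<open>s\<close> tends
  to \<open>0\<close>.\<close>

lemma prox_subgradient:
  fixes h :: "'a::euclidean_space \<Rightarrow> ereal"
  assumes h: "\<And>y. h y \<noteq> -\<infinity>" "closed_fun h" "proper_fun h" "convex_fun h"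
    and \<gamma>: "\<gamma> > 0" and p: "p = prox (\<lambda>y. ereal \<gamma> * h y) z"
  obtains r where "h p = ereal r"
    "\<And>w t. h w \<le> ereal t \<Longrightarrow> \<gamma> * r + (z - p) \<bullet> (w - p) \<le> \<gamma> * t"
proof -
  obtain r where r: "h p = ereal r"
    and min: "\<And>x t. h x \<le> ereal t \<Longrightarrow>
      \<gamma> * r + 1/2 * (norm (p - z))\<^sup>2 \<le> \<gamma> * t + 1/2 * (norm (x - z))\<^sup>2"
    unfolding p using prox_minimizes[OF h \<gamma>, of z] by blast
  show thesis
  proof (rule that[OF r])
    fix w t assume w: "h w \<le> ereal t"
    define N where "N = 1/2 * (norm (w - p))\<^sup>2"
    have step: "\<gamma> * r + (z - p) \<bullet> (w - p) \<le> \<gamma> * t + s * N" if s: "0 < s" "s \<le> 1" for s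
    proof -
      have "(1 - s) *\<^sub>R (p, r) + s *\<^sub>R (w, t) \<in> epi h"
        using h(4) s w r unfolding convex_fun_def
        by (intro convexD) (auto simp: epi_def)
      then have "h (p + s *\<^sub>R (w - p)) \<le> ereal (r + s * (t - r))"
        by (simp add: epi_def algebra_simps)
      from min[OF this]
      have "s * (\<gamma> * r + (z - p) \<bullet> (w - p)) \<le> s * (\<gamma> * t + s * N)"
        unfolding N_def power2_norm_eq_inner
        by (simp add: inner_simps inner_commute algebra_simps)
      then show ?thesis
        using s by simp
    qed
    have "((\<lambda>s. \<gamma> * t + s * N) \<longlongrightarrow> \<gamma> * t + 0 * N) (at_right 0)"
      by (intro tendsto_intros)
    moreover have "\<forall>\<^sub>F s in at_right 0. \<gamma> * r + (z - p) \<bullet> (w - p) \<le> \<gamma> * t + s * N"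
      using eventually_at_right_real[of 0 1] by (rule eventually_mono) (auto intro: step)
    ultimately show "\<gamma> * r + (z - p) \<bullet> (w - p) \<le> \<gamma> * t"
      using tendsto_lowerbound by fastforce
  qed
qed

section \<open>Sequences with telescoping bounds\<close>

text \<open>The averages cannot stay above \<open>0\<close> because the sums are bounded above, and cannot stay below
  because almost all terms exceed \<open>- \<delta> / 2\<close>.\<close>

lemma average_tendsto_0:
  fixes e :: "nat \<Rightarrow> real"
  assumes bound: "\<And>K. (\<Sum>k<K. e k) \<le> C"
    and low: "\<And>\<delta>. \<delta> > 0 \<Longrightarrow> \<forall>\<^sub>F k in sequentially. - \<delta> < e k"
  shows "(\<lambda>K. (\<Sum>k<Suc K. e k) / Suc K) \<longlonglongrightarrow> 0"
proof (rule tendstoI)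
  fix \<delta> :: real assume \<delta>: "\<delta> > 0"
  have "\<forall>\<^sub>F k in sequentially. - (\<delta>/2) < e k"
    using \<delta> by (intro low) simp
  then obtain N where N: "\<And>k. k \<ge> N \<Longrightarrow> - (\<delta>/2) < e k"
    unfolding eventually_sequentially by blast
  define D where "D = (\<Sum>k<N. \<bar>e k\<bar>)"
  \<comment> \<open>\<open>D\<close> absorbs the finitely many terms that may lie below \<open>- \<delta> / 2\<close>.\<close>
  have lower: "- D - K * (\<delta>/2) \<le> (\<Sum>k<K. e k)" for K
  proof (induction K)
    case 0
    then show ?case by (simp add: D_def sum_nonneg)
  next
    case (Suc K)
    show ?case
    proof (cases "K < N")
      case True
      have "- (\<Sum>k<Suc K. e k) \<le> (\<Sum>k<Suc K. \<bar>e k\<bar>)"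
        unfolding sum_negf[symmetric] by (intro sum_mono) auto
      also have "\<dots> \<le> D"
        unfolding D_def using True by (intro sum_mono2) auto
      finally have "- D \<le> (\<Sum>k<Suc K. e k)"
        by linarith
      moreover have "0 \<le> Suc K * (\<delta>/2)"
        using \<delta> by simp
      ultimately show ?thesis
        by linarith
    next
      case False
      then show ?thesis using Suc N[of K] by (simp add: field_simps)
    qed
  qed
  obtain m :: nat where m: "m > 2 * (\<bar>C\<bar> + D) / \<delta>"
    using reals_Archimedean2 by blast
  have D0: "0 \<le> D" by (simp add: D_def sum_nonneg)
  show "\<forall>\<^sub>F K in sequentially. dist ((\<Sum>k<Suc K. e k) / Suc K) 0 < \<delta>"
    unfolding eventually_sequentially
  proof (intro exI allI impI)
    fix K assume "m \<le> K"
    then have "2 * (\<bar>C\<bar> + D) / \<delta> < Suc K"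
      using m by linarith
    then have big: "\<bar>C\<bar> + D < Suc K * (\<delta>/2)"
      using \<delta> by (simp add: field_simps)
    have *: "Suc K * \<delta> = Suc K * (\<delta>/2) + Suc K * (\<delta>/2)" by simp
    have "\<bar>\<Sum>k<Suc K. e k\<bar> < Suc K * \<delta>"
      using lower[of "Suc K"] bound[of "Suc K"] big D0 unfolding * by linarith
    then show "dist ((\<Sum>k<Suc K. e k) / Suc K) 0 < \<delta>"
      by (simp add: dist_norm abs_divide field_simps)
  qed
qed

text \<open>If the terms were eventually at least \<open>\<delta>\<close>, the partial sums would grow without bound.\<close>

lemma frequently_small:
  fixes e :: "nat \<Rightarrow> real"
  assumes bound: "\<And>K. (\<Sum>k<K. e k) \<le> C" and \<delta>: "\<delta> > 0"
  shows "\<exists>\<^sub>F k in sequentially. e k < \<delta>"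
proof (rule ccontr)
  assume "\<not> ?thesis"
  then obtain N where N: "\<And>k. k \<ge> N \<Longrightarrow> \<delta> \<le> e k"
    by (auto simp: not_frequently eventually_sequentially not_less)
  have grow: "(\<Sum>k<N. e k) + m * \<delta> \<le> (\<Sum>k<N + m. e k)" for m :: nat
  proof (induction m)
    case (Suc m)
    then show ?case using N[of "N + m"] by (simp add: algebra_simps)
  qed simp
  obtain m :: nat where "m > (C - (\<Sum>k<N. e k)) / \<delta>"
    using reals_Archimedean2 by blast
  then have "(\<Sum>k<N. e k) + m * \<delta> > C"
    using \<delta> by (simp add: field_simps)
  then show False
    using grow[of m] bound[of "N + m"] by linarith
qed

text \<open>For a fixed \<open>\<epsilon>\<close>, both bounds on \<open>e\<close> telescope, so that \<open>(norm (d k))\<^sup>2\<close> has average at most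
  \<open>2 * \<gamma> * \<epsilon>\<close> up to a term of order \<open>1 / K\<close>. For a nonincreasing sequence the last term is bounded by
  the average, so it is enough that \<open>\<epsilon>\<close> is arbitrary. The vectors \<open>\<nu>\<close> may depend on \<open>\<epsilon>\<close> in an
  unbounded way.\<close>

lemma increments_tendsto_0:
  fixes z :: "nat \<Rightarrow> 'a::real_inner" and e :: "nat \<Rightarrow> real"
  defines "d \<equiv> \<lambda>k. z (Suc k) - z k"
  assumes \<gamma>: "\<gamma> > 0"
    and upper: "\<And>k. 2 * \<gamma> * e k \<le> (norm (z k - s))\<^sup>2 - (norm (z (Suc k) - s))\<^sup>2 - (norm (d k))\<^sup>2"
    and lower: "\<And>\<epsilon>. \<epsilon> > 0 \<Longrightarrow> \<exists>\<nu>. \<forall>k. - \<epsilon> - \<nu> \<bullet> d k \<le> e k"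
    and mono: "\<And>k. norm (d (Suc k)) \<le> norm (d k)"
  shows "d \<longlonglongrightarrow> 0"
proof -
  have small: "\<forall>\<^sub>F K in sequentially. norm (d K) < \<delta>" if \<delta>: "\<delta> > 0" for \<delta>
  proof -
    \<comment> \<open>With this choice \<open>2 * \<gamma> * \<epsilon>\<close> is \<open>\<delta>\<^sup>2 / 2\<close>, which leaves another
      \<open>\<delta>\<^sup>2 / 2\<close> for \<open>A / K\<close>.\<close>
    define \<epsilon> where "\<epsilon> = \<delta>\<^sup>2 / (4 * \<gamma>)"
    have "\<epsilon> > 0" using \<delta> \<gamma> by (simp add: \<epsilon>_def)
    from lower[OF this] obtain \<nu> where \<nu>: "\<And>k. - \<epsilon> - \<nu> \<bullet> d k \<le> e k"
      by blast
    define A where "A = (norm (z 0 - s - \<gamma> *\<^sub>R \<nu>))\<^sup>2"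
    \<comment> \<open>The linear term \<open>\<nu> \<bullet> d k\<close> telescopes as well; it moves the centre from \<open>s\<close> to \<open>s + \<gamma> *\<^sub>R \<nu>\<close>.\<close>
    have step: "(norm (d k))\<^sup>2 \<le> (norm (z k - s - \<gamma> *\<^sub>R \<nu>))\<^sup>2
        - (norm (z (Suc k) - s - \<gamma> *\<^sub>R \<nu>))\<^sup>2 + 2 * \<gamma> * \<epsilon>" for k
    proof -
      have "2 * \<gamma> * (- \<epsilon> - \<nu> \<bullet> d k) \<le> 2 * \<gamma> * e k"
        using \<nu>[of k] \<gamma> by simp
      then show ?thesis
        using upper[of k] unfolding d_def power2_norm_eq_inner
        by (simp add: inner_simps inner_commute algebra_simps)
    qed
    have sum: "(\<Sum>k<K. (norm (d k))\<^sup>2)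
        \<le> A - (norm (z K - s - \<gamma> *\<^sub>R \<nu>))\<^sup>2 + K * (2 * \<gamma> * \<epsilon>)" for K
    proof (induction K)
      case 0
      then show ?case by (simp add: A_def)
    next
      case (Suc K)
      then show ?case using step[of K] by (simp add: algebra_simps)
    qed
    have dec: "(norm (d K))\<^sup>2 \<le> (norm (d k))\<^sup>2" if "k \<le> K" for k K
      using lift_Suc_antimono_le[of "\<lambda>k. norm (d k)", OF mono that] by (intro power_mono) auto
    have bound: "K * (norm (d K))\<^sup>2 \<le> A + K * (\<delta>\<^sup>2 / 2)" for K
    proof -
      have "K * (norm (d K))\<^sup>2 = (\<Sum>k<K. (norm (d K))\<^sup>2)"
        by simp
      also have "\<dots> \<le> (\<Sum>k<K. (norm (d k))\<^sup>2)"
        by (intro sum_mono dec) auto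
      also have "\<dots> \<le> A + K * (2 * \<gamma> * \<epsilon>)"
        using sum[of K] by (smt (verit) zero_le_power2)
      also have "2 * \<gamma> * \<epsilon> = \<delta>\<^sup>2 / 2"
        using \<gamma> by (simp add: \<epsilon>_def)
      finally show ?thesis .
    qed
    obtain m :: nat where m: "m > 2 * A / \<delta>\<^sup>2"
      using reals_Archimedean2 by blast
    show ?thesis
      unfolding eventually_sequentially
    proof (intro exI allI impI)
      fix K assume "m \<le> K"
      then have "2 * A / \<delta>\<^sup>2 < K"
        using m by linarith
      then have A: "A < K * (\<delta>\<^sup>2 / 2)"
        using \<delta> by (simp add: field_simps)
      have "K > 0"
        using A by (cases K) (auto simp: A_def)
      moreover have "K * (norm (d K))\<^sup>2 < K * \<delta>\<^sup>2"
        using bound[of K] A by simp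
      ultimately have "(norm (d K))\<^sup>2 < \<delta>\<^sup>2"
        by simp
      then show "norm (d K) < \<delta>"
        using \<delta> by (simp add: power2_less_imp_less)
    qed
  qed
  then show ?thesis
    by (intro tendstoI) (simp add: dist_norm)
qed

section \<open>Duality and lower semicontinuity\<close>

text \<open>A dual point with value above \<open>c\<close> certifies \<open>c\<close> as a lower bound for the primal problem with
  decoupled variables \<open>x\<close> and \<open>y\<close>, up to a linear price \<open>\<nu>\<close> for violating \<open>x = y\<close>. This is the
  Fenchel-Young inequality for \<open>f\<close> at \<open>\<nu>\<close> and for \<open>g\<close> at \<open>- \<nu>\<close>.\<close>

lemma dual_minorant:
  fixes f g :: "'a::real_inner \<Rightarrow> ereal"
  assumes f: "\<And>y. f y \<noteq> -\<infinity>" "proper_fun f" and g: "\<And>y. g y \<noteq> -\<infinity>" "proper_fun g"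
    and c: "ereal c < dual_value f g"
  obtains \<nu> where "\<And>x y. ereal (c + \<nu> \<bullet> (x - y)) \<le> f x + g y"
proof -
  \<comment> \<open>Both conjugates avoid \<open>-\<infinity>\<close>, so a dual value above \<open>c\<close> is a difference of real numbers and not
    an artefact of \<open>\<infinity> - \<infinity>\<close>.\<close>
  have conj: "conjugate h \<mu> \<noteq> -\<infinity>" if h: "proper_fun h" for h :: "'a \<Rightarrow> ereal" and \<mu>
  proof -
    obtain x where "\<bar>h x\<bar> \<noteq> \<infinity>" using h unfolding proper_fun_def by (rule exE)
    then have "ereal (\<mu> \<bullet> x) - h x \<noteq> -\<infinity>" by (cases "h x") auto
    moreover have "ereal (\<mu> \<bullet> x) - h x \<le> conjugate h \<mu>"
      unfolding conjugate_def by (rule SUP_upper) simp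
    ultimately show ?thesis by auto
  qed
  obtain \<nu> where \<nu>: "ereal c < - conjugate f \<nu> - conjugate g (- \<nu>)"
    using c unfolding dual_value_def less_SUP_iff by blast
  obtain a where a: "conjugate f \<nu> = ereal a"
    using \<nu> conj[OF f(2), of \<nu>] conj[OF g(2), of "- \<nu>"]
    by (cases "conjugate f \<nu>"; cases "conjugate g (- \<nu>)") auto
  obtain b where b: "conjugate g (- \<nu>) = ereal b"
    using \<nu> a conj[OF g(2), of "- \<nu>"] by (cases "conjugate g (- \<nu>)") auto
  have ab: "c < - a - b" using \<nu> a b by simp
  have FY: "ereal (\<mu> \<bullet> x - v) \<le> h x" if "conjugate h \<mu> = ereal v" for h :: "'a \<Rightarrow> ereal" and \<mu> x v
  proof -
    have "ereal (\<mu> \<bullet> x) - h x \<le> ereal v"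
      unfolding that[symmetric] conjugate_def by (rule SUP_upper) simp
    then show ?thesis by (cases "h x") auto
  qed
  show thesis
  proof (rule that)
    fix x y
    have "ereal (\<nu> \<bullet> x - a) + ereal ((- \<nu>) \<bullet> y - b) \<le> f x + g y"
      by (intro add_mono FY a b)
    moreover have "c + \<nu> \<bullet> (x - y) \<le> (\<nu> \<bullet> x - a) + ((- \<nu>) \<bullet> y - b)"
      using ab by (simp add: inner_simps)
    ultimately show "ereal (c + \<nu> \<bullet> (x - y)) \<le> f x + g y"
      by (smt (verit) ereal_less_eq(3) order_trans plus_ereal.simps(1))
  qed
qed

text \<open>If infinitely many values were at most some \<open>c < h a\<close>, the corresponding points \<open>(X k, c)\<close> of the
  epigraph would converge to \<open>(a, c)\<close>, which lies outside it.\<close>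

lemma closed_fun_le_liminf:
  fixes h :: "'a::metric_space \<Rightarrow> ereal"
  assumes "closed_fun h" and X: "X \<longlonglongrightarrow> a"
  shows "h a \<le> liminf (\<lambda>k. h (X k))"
proof (rule ccontr)
  assume "\<not> ?thesis"
  then obtain c where c: "liminf (\<lambda>k. h (X k)) < ereal c" "ereal c < h a"
    using ereal_dense2[of "liminf (\<lambda>k. h (X k))" "h a"] by (auto simp: not_le)
  have "\<exists>\<^sub>F k in sequentially. h (X k) \<le> ereal c"
  proof (rule ccontr)
    assume "\<not> ?thesis"
    then have "\<forall>\<^sub>F k in sequentially. ereal c \<le> h (X k)"
      by (auto simp: not_frequently elim: eventually_mono)
    then have "ereal c \<le> liminf (\<lambda>k. h (X k))"
      by (rule Liminf_bounded)
    then show False using c by simp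
  qed
  then have "infinite {k. h (X k) \<le> ereal c}"
    by (simp add: frequently_cofinite flip: cofinite_eq_sequentially)
  then obtain r :: "nat \<Rightarrow> nat" where r: "strict_mono r" "\<And>n. h (X (r n)) \<le> ereal c"
    using infinite_enumerate by blast
  have in_epi: "(X (r n), c) \<in> epi h" for n
    using r by (simp add: epi_def)
  have lim: "(\<lambda>n. (X (r n), c)) \<longlonglongrightarrow> (a, c)"
    using LIMSEQ_subseq_LIMSEQ[OF X r(1)] by (intro tendsto_Pair) (auto simp: o_def)
  have "(a, c) \<in> epi h"
    using closed_sequentially[OF _ in_epi lim] assms(1) by (simp add: closed_fun_def)
  then show False
    using c by (simp add: epi_def)
qed

section \<open>Douglas--Rachford splitting\<close>

theorem theorem6:
  fixes f g :: "real ^ 'n \<Rightarrow> ereal"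
    and \<gamma> :: real
    and z0 :: "real ^ 'n"
    and xh x z :: "nat \<Rightarrow> real ^ 'n"
  assumes "\<And>y. f y \<noteq> -\<infinity>" and "\<And>y. g y \<noteq> -\<infinity>"
    and "closed_fun f" and "proper_fun f" and "convex_fun f"
    and "closed_fun g" and "proper_fun g" and "convex_fun g"
    and "\<gamma> > 0"
    and "drs_iterates f g \<gamma> z0 xh x z"
    and "dual_value f g = primal_value f g" and "\<bar>primal_value f g\<bar> \<noteq> \<infinity>"
    and "\<exists>y. primal_solution f g y"
    and "\<nexists>\<nu>. dual_solution f g \<nu>"
  shows "((\<lambda>k. x (Suc k) - xh k) \<longlonglongrightarrow> 0) \<and>
    ((\<lambda>k. (\<Sum>i=0..k. f (xh i) + g (x (Suc i))) / ereal (real (k + 1)))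
       \<longlonglongrightarrow> primal_value f g) \<and>
    liminf (\<lambda>k. f (xh k) + g (x (Suc k))) = primal_value f g \<and>
    (\<forall>xs. (xh \<longlonglongrightarrow> xs) \<longleftrightarrow> ((\<lambda>k. x (Suc k)) \<longlonglongrightarrow> xs)) \<and>
    (\<forall>xs. (xh \<longlonglongrightarrow> xs) \<longrightarrow> primal_solution f g xs)"
proof -
  note f = assms(1,3,4,5) and g = assms(2,6,7,8) and \<gamma> = assms(9)
  have xh: "xh k = prox (\<lambda>y. ereal \<gamma> * f y) (z k)"
    and x: "x (Suc k) = prox (\<lambda>y. ereal \<gamma> * g y) (2 *\<^sub>R xh k - z k)"
    and z: "z (Suc k) = z k + x (Suc k) - xh k" for k
    using assms(10) by (auto simp: drs_iterates_def)
  define d where "d = (\<lambda>k. z (Suc k) - z k)"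
  have d: "d k = x (Suc k) - xh k" for k
    by (simp add: d_def z)
  obtain p where p: "primal_value f g = ereal p"
    using assms(12) by (cases "primal_value f g") auto
  obtain s where "primal_solution f g s"
    using assms(13) by blast
  then have "f s + g s = ereal p"
    by (simp add: primal_solution_def p)
  then obtain fs gs where s: "f s = ereal fs" "g s = ereal gs" "fs + gs = p"
    using f(1)[of s] g(1)[of s] by (cases "f s"; cases "g s") auto
  have "\<exists>r. f (xh k) = ereal r \<and>
      (\<forall>w t. f w \<le> ereal t \<longrightarrow> \<gamma> * r + (z k - xh k) \<bullet> (w - xh k) \<le> \<gamma> * t)" for k
    using prox_subgradient[OF f \<gamma> xh] by metis
  then obtain F where F: "\<And>k. f (xh k) = ereal (F k)"
    and F_sub: "\<And>k w t. f w \<le> ereal t \<Longrightarrow> \<gamma> * F k + (z k - xh k) \<bullet> (w - xh k) \<le> \<gamma> * t"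
    by metis
  have "\<exists>r. g (x (Suc k)) = ereal r \<and>
      (\<forall>w t. g w \<le> ereal t \<longrightarrow>
        \<gamma> * r + (2 *\<^sub>R xh k - z k - x (Suc k)) \<bullet> (w - x (Suc k)) \<le> \<gamma> * t)" for k
    using prox_subgradient[OF g \<gamma> x] by metis
  then obtain G where G: "\<And>k. g (x (Suc k)) = ereal (G k)"
    and G_sub: "\<And>k w t. g w \<le> ereal t \<Longrightarrow>
        \<gamma> * G k + (2 *\<^sub>R xh k - z k - x (Suc k)) \<bullet> (w - x (Suc k)) \<le> \<gamma> * t"
    by metis
  define e where "e = (\<lambda>k. F k + G k - p)"
  have value_eq: "f (xh k) + g (x (Suc k)) = ereal (p + e k)" for k
    by (simp add: F G e_def)

  \<comment> \<open>The sum of the two subgradient inequalities at \<open>s\<close> is \<open>\<gamma> * e k \<le> - (d k \<bullet> (z (Suc k) - s))\<close>; the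
    polarization identity rewrites the inner product as a difference of squares.\<close>
  have upper: "2 * \<gamma> * e k \<le> (norm (z k - s))\<^sup>2 - (norm (z (Suc k) - s))\<^sup>2 - (norm (d k))\<^sup>2" for k
    using F_sub[of s fs k] G_sub[of s gs k] s unfolding e_def d z power2_norm_eq_inner
    by (simp add: s(3)[symmetric] inner_simps inner_commute algebra_simps)

  have lower: "\<exists>\<nu>. \<forall>k. - \<epsilon> - \<nu> \<bullet> d k \<le> e k" if "\<epsilon> > 0" for \<epsilon>
  proof -
    have "ereal (p - \<epsilon>) < dual_value f g"
      using that assms(11) p by simp
    then obtain \<nu> where \<nu>: "\<And>u v. ereal (p - \<epsilon> + \<nu> \<bullet> (u - v)) \<le> f u + g v"
      using dual_minorant[OF f(1,3) g(1,3)] by blast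
    have "- \<epsilon> - \<nu> \<bullet> d k \<le> e k" for k
      using \<nu>[of "xh k" "x (Suc k)"] unfolding value_eq d by (simp add: inner_simps)
    then show ?thesis by blast
  qed

  \<comment> \<open>Monotonicity of the subdifferentials of \<open>f\<close> and \<open>g\<close>, applied to two consecutive iterations, makes
    the map from \<open>z k\<close> to \<open>z (Suc k)\<close> nonexpansive along the iterates.\<close>
  have mono: "norm (d (Suc k)) \<le> norm (d k)" for k
  proof -
    define a where "a = xh (Suc k) - xh k"
    define b where "b = x (Suc (Suc k)) - x (Suc k)"
    have f_mono: "a \<bullet> a \<le> d k \<bullet> a"
      using F_sub[of "xh (Suc k)" "F (Suc k)" k] F_sub[of "xh k" "F k" "Suc k"] F
      unfolding a_def d z by (simp add: inner_simps inner_commute algebra_simps)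
    have g_mono: "b \<bullet> b \<le> 2 * (a \<bullet> b) - d k \<bullet> b"
      using G_sub[of "x (Suc (Suc k))" "G (Suc k)" k] G_sub[of "x (Suc k)" "G k" "Suc k"] G
      unfolding a_def b_def d z by (simp add: inner_simps inner_commute algebra_simps)
    have eq: "d (Suc k) = d k + b - a"
      by (simp add: a_def b_def d)
    have "(norm (d k + b - a))\<^sup>2 \<le> (norm (d k))\<^sup>2"
      using f_mono g_mono inner_ge_zero[of "a - b"] unfolding power2_norm_eq_inner
      by (simp add: inner_simps inner_commute algebra_simps)
    then show ?thesis
      unfolding eq by (rule power2_le_imp_le) simp
  qed

  have d0: "d \<longlonglongrightarrow> 0"
    using increments_tendsto_0[of \<gamma> e z s, folded d_def] \<gamma> upper lower mono
    unfolding d_def by blast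

  have e_low: "\<forall>\<^sub>F k in sequentially. - \<delta> < e k" if "\<delta> > 0" for \<delta>
  proof -
    have "\<exists>\<nu>. \<forall>k. - (\<delta>/2) - \<nu> \<bullet> d k \<le> e k"
      using that by (intro lower) simp
    then obtain \<nu> where \<nu>: "\<And>k. - (\<delta>/2) - \<nu> \<bullet> d k \<le> e k"
      by blast
    have "(\<lambda>k. - (\<delta>/2) - \<nu> \<bullet> d k) \<longlonglongrightarrow> - (\<delta>/2) - \<nu> \<bullet> 0"
      by (intro tendsto_intros d0)
    then have "\<forall>\<^sub>F k in sequentially. - \<delta> < - (\<delta>/2) - \<nu> \<bullet> d k"
      using that by (intro order_tendstoD) auto
    then show ?thesis
      by (rule eventually_mono) (use \<nu> in \<open>smt (verit)\<close>)
  qed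

  have e_sum: "(\<Sum>k<K. e k) \<le> (norm (z 0 - s))\<^sup>2 / (2 * \<gamma>)" for K
  proof -
    have "2 * \<gamma> * (\<Sum>k<K. e k) \<le> (norm (z 0 - s))\<^sup>2 - (norm (z K - s))\<^sup>2"
    proof (induction K)
      case (Suc K)
      then show ?case using upper[of K] by (simp add: distrib_left) (smt (verit) zero_le_power2)
    qed simp
    then have "2 * \<gamma> * (\<Sum>k<K. e k) \<le> (norm (z 0 - s))\<^sup>2"
      by (smt (verit) zero_le_power2)
    then show ?thesis using \<gamma> by (simp add: field_simps)
  qed

  have gap: "(\<lambda>k. x (Suc k) - xh k) \<longlonglongrightarrow> 0"
    using d0 by (simp add: d[abs_def])

  have average: "(\<lambda>k. (\<Sum>i=0..k. f (xh i) + g (x (Suc i))) / ereal (real (k + 1)))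
       \<longlonglongrightarrow> primal_value f g"
  proof -
    have eq: "(\<Sum>i=0..k. f (xh i) + g (x (Suc i))) / ereal (real (k + 1))
        = ereal (p + (\<Sum>i<Suc k. e i) / Suc k)" for k
    proof -
      have "(\<Sum>i=0..k. p + e i) = Suc k * p + (\<Sum>i<Suc k. e i)"
        by (simp add: sum.distrib atLeast0AtMost lessThan_Suc_atMost)
      then show ?thesis
        unfolding value_eq sum_ereal by (simp add: add_divide_distrib del: sum.lessThan_Suc)
    qed
    have "(\<lambda>k. p + (\<Sum>i<Suc k. e i) / Suc k) \<longlonglongrightarrow> p + 0"
      by (intro tendsto_intros average_tendsto_0[OF e_sum e_low])
    then show ?thesis
      unfolding eq p by simp
  qed

  have liminf: "liminf (\<lambda>k. f (xh k) + g (x (Suc k))) = primal_value f g"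
  proof (rule antisym)
    show "primal_value f g \<le> liminf (\<lambda>k. f (xh k) + g (x (Suc k)))"
      unfolding le_Liminf_iff p
    proof (intro allI impI)
      fix y assume "y < ereal p"
      then obtain c where c: "y < ereal c" "ereal c < ereal p"
        using ereal_dense2 by blast
      then have "\<forall>\<^sub>F k in sequentially. - (p - c) < e k"
        by (intro e_low) simp
      then show "\<forall>\<^sub>F k in sequentially. y < f (xh k) + g (x (Suc k))"
        unfolding value_eq
        by (rule eventually_mono) (auto intro!: less_trans[OF c(1)])
    qed
    show "liminf (\<lambda>k. f (xh k) + g (x (Suc k))) \<le> primal_value f g"
    proof (rule ccontr)
      assume "\<not> ?thesis"
      then obtain c where c: "ereal p < ereal c" "ereal c < liminf (\<lambda>k. f (xh k) + g (x (Suc k)))"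
        using ereal_dense2[of "ereal p"] by (auto simp: not_le p)
      then have "\<forall>\<^sub>F k in sequentially. ereal c < f (xh k) + g (x (Suc k))"
        using less_LiminfD by blast
      then have "\<forall>\<^sub>F k in sequentially. \<not> e k < c - p"
        unfolding value_eq by (rule eventually_mono) simp
      moreover have "\<exists>\<^sub>F k in sequentially. e k < c - p"
        using c by (intro frequently_small[OF e_sum]) simp
      ultimately show False
        by (simp add: frequently_def)
    qed
  qed

  have equiv: "(xh \<longlonglongrightarrow> xs) \<longleftrightarrow> ((\<lambda>k. x (Suc k)) \<longlonglongrightarrow> xs)" for xs
    using tendsto_add[OF _ gap, of xh xs] tendsto_diff[OF _ gap, of "\<lambda>k. x (Suc k)" xs] by auto

  have "primal_solution f g xs" if xs: "xh \<longlonglongrightarrow> xs" for xs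
  proof -
    let ?lf = "liminf (\<lambda>k. f (xh k))" and ?lg = "liminf (\<lambda>k. g (x (Suc k)))"
    have lf: "f xs \<le> ?lf"
      using closed_fun_le_liminf[OF f(2) xs] .
    have lg: "g xs \<le> ?lg"
      using closed_fun_le_liminf[OF g(2)] xs equiv by blast
    have "f xs + g xs \<le> ?lf + ?lg"
      using lf lg by (rule add_mono)
    \<comment> \<open>Both limits inferior exceed \<open>-\<infinity>\<close>, as \<open>lf\<close> and \<open>lg\<close> bound them from below, so their sum is not
      of the form \<open>\<infinity> - \<infinity>\<close>.\<close>
    also have "\<dots> \<le> liminf (\<lambda>k. f (xh k) + g (x (Suc k)))"
      using lf lg f(1)[of xs] g(1)[of xs] by (intro ereal_liminf_add_mono) auto
    finally have "f xs + g xs \<le> primal_value f g"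
      by (simp add: liminf)
    moreover have "primal_value f g \<le> f xs + g xs"
      unfolding primal_value_def by (rule INF_lower) simp
    ultimately show ?thesis
      by (simp add: primal_solution_def)
  qed
  then show ?thesis
    using gap average liminf equiv by blast
qed

end
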